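(* Let $n\ge 3$ be an integer, let $h$ be a positive integer with $h<n/2$, and let $\psi_h$ be the irreducible character of degree 2 of the dihedral group $D_n\subset S_n$ given by $\psi_h(\sigma^k)=2\cos\frac{2\pi hk}{n}$ and $\psi_h(\tau\sigma^k)=0$ for all $k$. Then the dimension of the vector space $H_d(D_n,\psi_h)$ of relative symmetric polynomials of degree $d\ge 0$ is as follows. Case (i): if $h$ is coprime to $n$, then for every integer $d\ge 0$ \[ \dim H_d(D_n,\psi_h)=\frac{2}{n}\sum_{r\mid n}\binom{r+\frac{d}{n/r}-1}{r-1}\,\mu\!\left(\frac{n}{r}\right), \] and the generating function is \[ \sum_{d=0}^\infty \dim H_d(D_n,\psi_h)\,t^d=\frac{2}{n}\sum_{r\mid n}\mu\!\left(\frac{n}{r}\right)\left(1-t^{n/r}\right)^{-r}. \] Case (ii): if $h$ is not coprime to $n$, then, writing $g=\gcd\left(h,\frac{n}{r}\right)$ (which depends on $r$), for every integer $d\ge 0$ \[ \dim H_d(D_n,\psi_h)=\frac{2}{n}\sum_{r\mid n}\binom{r+\frac{d}{n/r}-1}{r-1}\,\mu\!\left(\frac{n/r}{g}\right)\frac{\phi\left(\frac{n}{r}\right)}{\phi\left(\frac{n/r}{g}\right)}, \] and the generating function is \[ \sum_{d=0}^\infty \dim H_d(D_n,\psi_h)\,t^d=\frac{2}{n}\sum_{r\mid n}\mu\!\left(\frac{n/r}{g}\right)\frac{\phi\left(\frac{n}{r}\right)}{\phi\left(\frac{n/r}{g}\right)}\left(1-t^{n/r}\right)^{-r}. \] Here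 the sums run over the positive divisors $r$ of $n$, and the generating functions are identities of formal power series in $t$.
   Context: $\mu$ is the Möbius function and $\phi$ is Euler's totient function. $D_n$ is the dihedral group of order $2n$, $D_n=\{1,\sigma,\dots,\sigma^{n-1},\tau,\tau\sigma,\dots,\tau\sigma^{n-1}\}$, embedded in the symmetric group $S_n$ with $\sigma$ the $n$-cycle $(1\,2\,3\cdots n)$ and $\tau$ the reversal permutation $\tau(j)=n+1-j$. $H_d=H_d(x_1,\dots,x_n)$ is the complex vector space of homogeneous polynomials of degree $d$ in $x_1,\dots,x_n$ (together with $0$); $S_n$ and its subgroups act linearly on it by permuting the variables. For a subgroup $G\subset S_n$ and an irreducible (here real-valued) character $\chi$ of $G$, the space $H_d(G,\chi)$ of relative symmetric polynomials of degree $d$ of $G$ relative to $\chi$ is the image in $H_d$ of the projection operator \[ T(G,\chi)=\frac{\chi(1)}{|G|}\sum_{g\in G}\chi(g)\,g . \] Convention on binomial coefficients: $\binom{a}{b}$ is interpreted as $0$ whenever $a$ or $b$ is not a nonnegative integer. In particular the term for $r$ vanishes when $\frac{n}{r}$ does not divide $d$. *)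

theory Defs
  imports
    Complex_Main
    "HOL-Library.Poly_Mapping"
    "HOL-Computational_Algebra.Computational_Algebra"
    "HOL-Number_Theory.Number_Theory"
    "HOL-Algebra.Sym_Groups"
begin

section \<open>Homogeneous polynomials and the action of the symmetric group\<close>

text \<open>A monomial maps the index \<open>i\<close> of the variable \<open>x\<^sub>i\<close> to its exponent; a polynomial maps
  monomials to coefficients.\<close>

type_synonym monom = "nat \<Rightarrow>\<^sub>0 nat"
type_synonym cpoly = "monom \<Rightarrow>\<^sub>0 complex"

definition cpoly_scale :: "complex \<Rightarrow> cpoly \<Rightarrow> cpoly"
  where "cpoly_scale c p = Poly_Mapping.map ((*) c) p"

lemma lookup_cpoly_scale [simp]:
  "Poly_Mapping.lookup (cpoly_scale c p) m = c * Poly_Mapping.lookup p m"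
  unfolding cpoly_scale_def by (simp add: Poly_Mapping.map.rep_eq when_def)

lemma vector_space_cpoly_scale: "vector_space cpoly_scale"
  by unfold_locales (auto intro!: poly_mapping_eqI simp: lookup_add algebra_simps)

definition monom_degree :: "monom \<Rightarrow> nat"
  where "monom_degree m = (\<Sum>i\<in>Poly_Mapping.keys m. Poly_Mapping.lookup m i)"

definition hom_polys :: "nat \<Rightarrow> nat \<Rightarrow> cpoly set"
  where "hom_polys n d =
    {p. \<forall>m\<in>Poly_Mapping.keys p. Poly_Mapping.keys m \<subseteq> {1..n} \<and> monom_degree m = d}"

text \<open>The action of a permutation \<open>g\<close> sends \<open>x\<^sub>i\<close> to \<open>x\<^bsub>g i\<^esub>\<close>.\<close>

definition perm_monom :: "(nat \<Rightarrow> nat) \<Rightarrow> monom \<Rightarrow> monom"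
  where "perm_monom g m =
    (\<Sum>i\<in>Poly_Mapping.keys m. Poly_Mapping.single (g i) (Poly_Mapping.lookup m i))"

definition perm_poly :: "(nat \<Rightarrow> nat) \<Rightarrow> cpoly \<Rightarrow> cpoly"
  where "perm_poly g p =
    (\<Sum>m\<in>Poly_Mapping.keys p. Poly_Mapping.single (perm_monom g m) (Poly_Mapping.lookup p m))"

section \<open>Relative symmetric polynomials\<close>

definition sym_operator ::
    "(nat \<Rightarrow> nat) set \<Rightarrow> ((nat \<Rightarrow> nat) \<Rightarrow> real) \<Rightarrow> cpoly \<Rightarrow> cpoly"
  where "sym_operator G \<chi> p =
    cpoly_scale (of_real (\<chi> id / real (card G)))
      (\<Sum>g\<in>G. cpoly_scale (of_real (\<chi> g)) (perm_poly g p))"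

definition rel_sym_polys ::
    "nat \<Rightarrow> nat \<Rightarrow> (nat \<Rightarrow> nat) set \<Rightarrow> ((nat \<Rightarrow> nat) \<Rightarrow> real) \<Rightarrow> cpoly set"
  where "rel_sym_polys n d G \<chi> = sym_operator G \<chi> ` hom_polys n d"

definition dim_rel_sym_polys ::
    "nat \<Rightarrow> nat \<Rightarrow> (nat \<Rightarrow> nat) set \<Rightarrow> ((nat \<Rightarrow> nat) \<Rightarrow> real) \<Rightarrow> nat"
  where "dim_rel_sym_polys n d G \<chi> =
    vector_space.dim cpoly_scale (rel_sym_polys n d G \<chi>)"

section \<open>The dihedral group and its characters of degree 2\<close>

definition rotation :: "nat \<Rightarrow> nat \<Rightarrow> nat"
  where "rotation n = cycle_of_list [1..<n + 1]"

definition reversal :: "nat \<Rightarrow> nat \<Rightarrow> nat"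
  where "reversal n j = (if j \<in> {1..n} then n + 1 - j else j)"

definition dihedral :: "nat \<Rightarrow> (nat \<Rightarrow> nat) set"
  where "dihedral n =
    {rotation n ^^ k | k. k < n} \<union> {reversal n \<circ> (rotation n ^^ k) | k. k < n}"

text \<open>The choice of the exponent is immaterial, see \<open>dihedral_char_rotation\<close> below.\<close>

definition dihedral_char :: "nat \<Rightarrow> nat \<Rightarrow> (nat \<Rightarrow> nat) \<Rightarrow> real"
  where "dihedral_char n h g =
    (if \<exists>k. g = rotation n ^^ k
     then 2 * cos (2 * pi * real h * real (LEAST k. g = rotation n ^^ k) / real n)
     else 0)"

lemma rotation_apply:
  assumes "j \<in> {1..n}"
  shows "(rotation n ^^ k) j = (j - 1 + k) mod n + 1"
proof -
  let ?l = "[1..<n + 1]"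
  have "map (rotation n ^^ k) ?l = rotate k ?l"
    unfolding rotation_def by (rule cyclic_rotation) simp
  moreover have "j - 1 < length ?l" and "?l ! (j - 1) = j"
    using assms by (auto simp del: upt_Suc)
  ultimately have "(rotation n ^^ k) j = rotate k ?l ! (j - 1)"
    by (metis nth_map)
  also have "\<dots> = ?l ! ((k + (j - 1)) mod n)"
    using \<open>j - 1 < length ?l\<close> by (subst nth_rotate) (simp_all del: upt_Suc)
  also have "\<dots> = (j - 1 + k) mod n + 1"
    using assms by (subst nth_upt) (auto simp: add.commute simp del: upt_Suc)
  finally show ?thesis .
qed

lemma rotation_outside:
  assumes "j \<notin> {1..n}"
  shows "(rotation n ^^ k) j = j"
proof (induction k)
  case (Suc k)
  have "rotation n j = j"
    unfolding rotation_def by (rule id_outside_supp) (use assms in auto)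
  with Suc show ?case by simp
qed simp

lemma rotation_pow_eq_iff:
  assumes "n > 0"
  shows "rotation n ^^ k = rotation n ^^ l \<longleftrightarrow> k mod n = l mod n"
proof
  assume "rotation n ^^ k = rotation n ^^ l"
  then have "(rotation n ^^ k) 1 = (rotation n ^^ l) 1" by simp
  then show "k mod n = l mod n"
    using assms by (simp add: rotation_apply)
next
  assume *: "k mod n = l mod n"
  show "rotation n ^^ k = rotation n ^^ l"
  proof
    fix j
    have "(j - 1 + k) mod n = (j - 1 + l) mod n"
      using * by (metis mod_add_right_eq)
    then show "(rotation n ^^ k) j = (rotation n ^^ l) j"
      by (cases "j \<in> {1..n}") (metis rotation_apply, metis rotation_outside)
  qed
qed

lemma dihedral_char_rotation:
  assumes "n > 0"
  shows "dihedral_char n h (rotation n ^^ k) = 2 * cos (2 * pi * real h * real k / real n)"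
proof -
  have "(LEAST l. rotation n ^^ k = rotation n ^^ l) = k mod n"
    by (rule Least_equality)
      (use assms in \<open>auto simp: rotation_pow_eq_iff intro: order.trans[OF _ mod_less_eq_dividend]\<close>)
  then have "dihedral_char n h (rotation n ^^ k)
      = 2 * cos (2 * pi * real h * real (k mod n) / real n)"
    unfolding dihedral_char_def by auto
  also have "cos (2 * pi * real h * real (k mod n) / real n)
      = cos (2 * pi * real h * real (k mod n) / real n + 2 * real (h * (k div n)) * pi)"
    by (simp only: cos_add cos_2npi sin_2npi)
  also have "2 * pi * real h * real (k mod n) / real n + 2 * real (h * (k div n)) * pi
      = 2 * pi * real h * (real (k mod n) + real n * real (k div n)) / real n"
    using assms by (simp add: field_simps)
  also have "real (k mod n) + real n * real (k div n) = real k"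
    by (metis mod_mult_div_eq of_nat_add of_nat_mult)
  finally show ?thesis by simp
qed

lemma dihedral_char_reflection:
  assumes "n \<ge> 3"
  shows "dihedral_char n h (reversal n \<circ> (rotation n ^^ k)) = 0"
proof -
  have False if "reversal n \<circ> (rotation n ^^ k) = rotation n ^^ l" for l
  proof -
    have e: "n - (j + k) mod n = (j + l) mod n + 1" if "j < n" for j
    proof -
      have "j + 1 \<in> {1..n}" using that by simp
      then have "reversal n ((j + k) mod n + 1) = (j + l) mod n + 1"
        using fun_cong[OF \<open>reversal n \<circ> (rotation n ^^ k) = rotation n ^^ l\<close>, of "j + 1"]
        by (simp only: o_apply rotation_apply) simp
      moreover have "(j + k) mod n < n" using assms by simp
      ultimately show ?thesis by (simp add: reversal_def)
    qed
    have i: "[int (2 * j + k + l + 1) = 0] (mod int n)" if "j < n" for j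
    proof -
      have "(j + k) mod n < n" using assms by simp
      then have "(j + k) mod n + (j + l) mod n + 1 = n" using e[OF that] by linarith
      then have "((j + k) + (j + l) + 1) mod n = 0"
        by (metis mod_add_eq mod_add_left_eq mod_self)
      then have "(2 * j + k + l + 1) mod n = 0" by (metis (no_types) add.assoc add.left_commute mult_2)
      then show ?thesis by (metis cong_def cong_int_iff of_nat_0 mod_0)
    qed
    have "[int (2 * 1 + k + l + 1) - int (2 * 0 + k + l + 1) = 0 - 0] (mod int n)"
      by (intro cong_diff i) (use assms in auto)
    then have "int n dvd 2" by (simp add: cong_0_iff)
    then show False using assms zdvd_imp_le by fastforce
  qed
  then show ?thesis unfolding dihedral_char_def by metis
qed

section \<open>Number-theoretic conventions\<close>

definition moebius :: "nat \<Rightarrow> int"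
  where "moebius n = (if squarefree n then (- 1) ^ card (prime_factors n) else 0)"

text \<open>The binomial coefficient, extended by \<open>0\<close> to arguments that are not nonnegative integers.\<close>

definition binom :: "real \<Rightarrow> real \<Rightarrow> real"
  where "binom a b = (if a \<in> \<nat> \<and> b \<in> \<nat> then real (nat \<lfloor>a\<rfloor> choose nat \<lfloor>b\<rfloor>) else 0)"

end

theory Submission
  imports Defs
begin

text \<open>The operator \<open>T\<close> is idempotent, so the dimension of its image is its trace. In the basis of
  monomials, a rotation contributes the number of monomials that it fixes, and the reflections
  contribute nothing since the character vanishes there. A rotation \<open>\<sigma>\<^sup>k\<close> with \<open>gcd k n = r\<close> has \<open>r\<close>
  cycles of length \<open>n/r\<close>, so it fixes as many monomials as there are ways to distribute \<open>d/(n/r)\<close>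
  over \<open>r\<close> cycles. For fixed \<open>r\<close>, the sum of the character values is twice the Ramanujan sum
  \<open>c\<^bsub>n/r\<^esub>(h)\<close>, which Hoelder's formula evaluates.\<close>

section \<open>The dimension of the image of an idempotent operator\<close>

context vector_space
begin

text \<open>Extend a basis \<open>B\<close> of the image to a basis \<open>C\<close> of
  \<open>V\<close>. The operator fixes \<open>B\<close> and sends the rest of \<open>C\<close> into
  the span of \<open>B\<close>, so its diagonal in \<open>C\<close> is 1 on \<open>B\<close> and 0
  elsewhere. Passing between \<open>C\<close> and the family \<open>e\<close> preserves the trace,
  because the trace of a product of two matrices does not depend on their order.\<close>

lemma dim_idempotent_image_eq_trace:
  assumes T: "Vector_Spaces.linear scale scale T"
    and V: "subspace V" "\<And>v. v \<in> V \<Longrightarrow> T v \<in> V"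
    and idem: "\<And>v. v \<in> V \<Longrightarrow> T (T v) = T v"
    and M: "finite M" "\<And>m. m \<in> M \<Longrightarrow> e m \<in> V"
    and \<phi>: "\<And>m. m \<in> M \<Longrightarrow> Vector_Spaces.linear scale (*) (\<phi> m)"
    and expand: "\<And>v. v \<in> V \<Longrightarrow> v = (\<Sum>m\<in>M. \<phi> m v *s e m)"
  shows "of_nat (dim (T ` V)) = (\<Sum>m\<in>M. \<phi> m (T (e m)))"
proof -
  interpret T: Vector_Spaces.linear scale scale T by (fact T)
  obtain B where B: "B \<subseteq> T ` V" "independent B" "T ` V \<subseteq> span B" "card B = dim (T ` V)"
    by (rule basis_exists)
  obtain C where C: "B \<subseteq> C" "C \<subseteq> V" "independent C" "V \<subseteq> span C"
    using B V(2) by (blast intro: maximal_independent_subset_extend[of B V])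
  define rep where "rep = representation C"
  \<comment> \<open>This bounds the size of every independent subset of \<open>V\<close>, so that
    \<open>C\<close> is finite and sums over it make sense.\<close>
  have "V \<subseteq> span (e ` M)"
  proof
    fix v assume "v \<in> V"
    then show "v \<in> span (e ` M)"
      by (subst expand) (auto intro!: span_sum span_scale intro: span_base)
  qed
  then have fin: "finite C"
    using C M(1) independent_span_bound[of "e ` M" C] by auto
  have rep_T: "rep (T c) c = (if c \<in> B then 1 else 0)" if "c \<in> C" for c
  proof (cases "c \<in> B")
    case True
    then have "T c = c" using B(1) idem by auto
    then show ?thesis using True that C(3) by (simp add: rep_def representation_basis)
  next
    case False
    have "T c \<in> span B" using that B(3) C(2) by blast
    then have "rep (T c) = representation B (T c)"
      unfolding rep_def using C by (intro representation_extend) auto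
    then show ?thesis using False representation_ne_zero by auto
  qed
  have TV: "T v \<in> span C" if "v \<in> V" for v using that V(2) C(4) by blast
  have T_expand: "rep (T c) c = (\<Sum>m\<in>M. \<phi> m c * rep (T (e m)) c)" if "c \<in> C" for c
  proof -
    have "T c = (\<Sum>m\<in>M. \<phi> m c *s T (e m))"
      using that C(2) by (subst expand) (auto simp: T.sum T.scale)
    then show ?thesis
      unfolding rep_def using C(3) M TV
      by (simp add: representation_sum representation_scale span_scale)
  qed
  have "\<phi> m (T (e m)) = (\<Sum>c\<in>C. rep (T (e m)) c * \<phi> m c)" if "m \<in> M" for m
  proof -
    interpret \<phi>: Vector_Spaces.linear scale "(*)" "\<phi> m" by (rule \<phi>) fact
    have "T (e m) = (\<Sum>c\<in>C. rep (T (e m)) c *s c)"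
      unfolding rep_def using C fin TV M that by (intro sum_representation_eq[symmetric]) auto
    then have "\<phi> m (T (e m)) = \<phi> m (\<Sum>c\<in>C. rep (T (e m)) c *s c)" by simp
    then show ?thesis by (simp add: \<phi>.sum \<phi>.scale)
  qed
  then have "(\<Sum>m\<in>M. \<phi> m (T (e m))) = (\<Sum>m\<in>M. \<Sum>c\<in>C. rep (T (e m)) c * \<phi> m c)"
    by simp
  also have "\<dots> = (\<Sum>c\<in>C. \<Sum>m\<in>M. \<phi> m c * rep (T (e m)) c)"
    by (subst sum.swap) (simp add: mult.commute)
  also have "\<dots> = (\<Sum>c\<in>C. if c \<in> B then 1 else 0)"
    using T_expand rep_T by (intro sum.cong) auto
  also have "\<dots> = of_nat (card B)"
    using C(1) fin by (simp add: sum.If_cases Int_absorb1)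
  finally show ?thesis using B(4) by simp
qed

end

section \<open>The action of permutations on monomials and polynomials\<close>

text \<open>A common form of \<open>perm_monom\<close>, which moves exponents along a map of
  variables, and \<open>perm_poly\<close>, which moves coefficients along a map of monomials. One
  set of lemmas then serves both levels.\<close>

definition pushforward :: "('a \<Rightarrow> 'b) \<Rightarrow> ('a \<Rightarrow>\<^sub>0 'c::comm_monoid_add) \<Rightarrow> 'b \<Rightarrow>\<^sub>0 'c"
  where "pushforward f p =
    (\<Sum>i\<in>Poly_Mapping.keys p. Poly_Mapping.single (f i) (Poly_Mapping.lookup p i))"

text \<open>Zero coefficients contribute nothing, so mappings with different keys can be summed over
  a common index set.\<close>

lemma pushforward_superset:
  assumes "finite S" "Poly_Mapping.keys p \<subseteq> S"
  shows "pushforward f p = (\<Sum>i\<in>S. Poly_Mapping.single (f i) (Poly_Mapping.lookup p i))"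
  unfolding pushforward_def using assms
  by (intro sum.mono_neutral_left) (auto simp: in_keys_iff)

lemma pushforward_zero [simp]: "pushforward f 0 = 0"
  by (simp add: pushforward_def)

lemma pushforward_single [simp]:
  "pushforward f (Poly_Mapping.single i c) = Poly_Mapping.single (f i) c"
  by (simp add: pushforward_def)

lemma pushforward_add: "pushforward f (p + q) = pushforward f p + pushforward f q"
  using Poly_Mapping.keys_add[of p q]
  by (simp add: pushforward_superset[of "Poly_Mapping.keys p \<union> Poly_Mapping.keys q"]
      lookup_add single_add sum.distrib)

lemma pushforward_sum: "pushforward f (sum p S) = (\<Sum>s\<in>S. pushforward f (p s))"
  by (induction S rule: infinite_finite_induct) (auto simp: pushforward_add)

lemma pushforward_pushforward: "pushforward f (pushforward g p) = pushforward (f \<circ> g) p"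
  by (subst (2) pushforward_def) (simp add: pushforward_sum, simp add: pushforward_def)

lemma lookup_pushforward:
  assumes "inj f"
  shows "Poly_Mapping.lookup (pushforward f p) (f i) = Poly_Mapping.lookup p i"
proof -
  have "Poly_Mapping.lookup (pushforward f p) (f i)
      = (\<Sum>j\<in>insert i (Poly_Mapping.keys p). if j = i then Poly_Mapping.lookup p j else 0)"
    using assms
    by (subst pushforward_superset[of "insert i (Poly_Mapping.keys p)"])
      (auto simp: lookup_sum lookup_single when_def inj_eq intro!: sum.cong)
  also have "\<dots> = Poly_Mapping.lookup p i" by (subst sum.delta) auto
  finally show ?thesis .
qed

lemma pushforward_fixed_iff:
  assumes "bij f"
  shows "pushforward f p = p \<longleftrightarrow>
    (\<forall>i. Poly_Mapping.lookup p (f i) = Poly_Mapping.lookup p i)"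
proof
  assume "pushforward f p = p"
  then show "\<forall>i. Poly_Mapping.lookup p (f i) = Poly_Mapping.lookup p i"
    using lookup_pushforward[of f p] assms by (auto simp: bij_def)
next
  assume *: "\<forall>i. Poly_Mapping.lookup p (f i) = Poly_Mapping.lookup p i"
  show "pushforward f p = p"
  proof (rule poly_mapping_eqI)
    fix j
    obtain i where "j = f i" using assms by (meson bij_pointE)
    then show "Poly_Mapping.lookup (pushforward f p) j = Poly_Mapping.lookup p j"
      using * lookup_pushforward[of f p i] assms by (simp add: bij_def)
  qed
qed

lemma perm_monom_eq: "perm_monom = pushforward"
  by (simp add: fun_eq_iff perm_monom_def pushforward_def)

lemma perm_poly_eq: "perm_poly g = pushforward (perm_monom g)"
  by (simp add: fun_eq_iff perm_poly_def pushforward_def)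

lemma perm_poly_perm_poly: "perm_poly f (perm_poly g p) = perm_poly (f \<circ> g) p"
proof -
  have "perm_monom f \<circ> perm_monom g = perm_monom (f \<circ> g)"
    by (simp add: fun_eq_iff perm_monom_eq pushforward_pushforward)
  then show ?thesis by (simp add: perm_poly_eq pushforward_pushforward)
qed

lemma perm_poly_scale: "perm_poly g (cpoly_scale c p) = cpoly_scale c (perm_poly g p)"
proof -
  \<comment> \<open>For \<open>c = 0\<close> the scaled polynomial loses its keys; the sum is
    therefore taken over the keys of \<open>p\<close>.\<close>
  have "perm_poly g (cpoly_scale c p) =
      (\<Sum>m\<in>Poly_Mapping.keys p.
        Poly_Mapping.single (perm_monom g m) (c * Poly_Mapping.lookup p m))"
    unfolding perm_poly_eq
    by (subst pushforward_superset[of "Poly_Mapping.keys p"]) (auto simp: in_keys_iff)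
  also have "\<dots> = cpoly_scale c (perm_poly g p)"
    by (intro poly_mapping_eqI)
      (simp add: perm_poly_def lookup_sum sum_distrib_left lookup_single when_def if_distrib
        cong: if_cong)
  finally show ?thesis .
qed

section \<open>Ramanujan sums\<close>

lemma moebius_Suc_0 [simp]: "moebius (Suc 0) = 1"
  by (simp add: moebius_def)

lemma moebius_prime: "prime p \<Longrightarrow> moebius p = - 1"
  by (simp add: moebius_def squarefree_prime prime_prime_factors)

lemma moebius_eq_0: "p ^ 2 dvd n \<Longrightarrow> \<not> is_unit p \<Longrightarrow> moebius n = 0"
  by (auto simp: moebius_def squarefree_def)

lemma moebius_mult_coprime:
  assumes "coprime a b"
  shows "moebius (a * b) = moebius a * moebius b"
proof (cases "squarefree a \<and> squarefree b")
  case True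
  then have "a \<noteq> 0" "b \<noteq> 0" by (metis not_squarefree_0)+
  moreover have "prime_factors a \<inter> prime_factors b = {}"
    using assms by (auto simp: in_prime_factors_iff dest: coprime_common_divisor not_prime_unit)
  ultimately show ?thesis
    using True assms squarefree_mult_coprime[OF assms]
    by (simp add: moebius_def prime_factors_product card_Un_disjoint power_add)
next
  case False
  then have "\<not> squarefree (a * b)" using squarefree_multD[of a b] by blast
  then show ?thesis using False by (auto simp: moebius_def)
qed

text \<open>In one direction the two gcds on the right are coprime divisors of \<open>h\<close>. In
  the other, a divisor of \<open>a * b\<close> splits into a divisor of \<open>a\<close> times a
  divisor of \<open>b\<close>.\<close>

lemma gcd_coprime_mult_right:
  fixes h :: nat
  assumes "coprime a b"
  shows "gcd h (a * b) = gcd h a * gcd h b"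
proof (rule dvd_antisym)
  have "coprime (gcd h a) (gcd h b)"
    using assms by (rule coprime_divisors[rotated 2]) simp_all
  then show "gcd h a * gcd h b dvd gcd h (a * b)"
    by (simp add: divides_mult mult_dvd_mono)
  have "gcd h (a * b) dvd a * b" by simp
  then obtain a' b' where *: "gcd h (a * b) = a' * b'" "a' dvd a" "b' dvd b"
    using division_decomp by blast
  then have "a' * b' dvd h" by (metis gcd_dvd1)
  then show "gcd h (a * b) dvd gcd h a * gcd h b"
    using * by (metis dvd_mult_left dvd_mult_right gcd_greatest mult_dvd_mono)
qed

text \<open>The value of the Ramanujan sum \<open>c\<^sub>m(h)\<close> according to Hoelder's formula.\<close>

definition hoelder :: "nat \<Rightarrow> nat \<Rightarrow> real"
  where "hoelder h m = of_int (moebius (m div gcd h m))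
    * (real (totient m) / real (totient (m div gcd h m)))"

text \<open>The gcd with a fixed \<open>h\<close>, the Moebius function and the totient are all
  multiplicative. This reduces divisor sums of \<open>hoelder\<close> to prime powers.\<close>

lemma hoelder_mult_coprime:
  assumes "coprime a b" "a > 0" "b > 0"
  shows "hoelder h (a * b) = hoelder h a * hoelder h b"
proof -
  have g: "gcd h (a * b) = gcd h a * gcd h b"
    using assms(1) by (rule gcd_coprime_mult_right)
  have "a * b div gcd h (a * b) = (a div gcd h a) * (b div gcd h b)"
    by (simp add: g div_mult_div_if_dvd)
  moreover have "coprime (a div gcd h a) (b div gcd h b)"
    by (rule coprime_divisors[OF _ _ assms(1)]) (metis dvd_div_mult_self dvd_triv_left gcd_dvd2)+
  ultimately show ?thesis
    using assms by (simp add: hoelder_def moebius_mult_coprime totient_mult_coprime)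
qed

text \<open>A divisor \<open>x\<close> of \<open>a * b\<close> is uniquely a divisor of
  \<open>a\<close> times a divisor of \<open>b\<close>; the two factors are recovered as
  \<open>gcd x a\<close> and \<open>gcd x b\<close>.\<close>

lemma sum_divisors_coprime_mult:
  fixes f :: "nat \<Rightarrow> 'a::comm_semiring_1"
  assumes "coprime a b" "a > 0" "b > 0"
    and f: "\<And>d e. d dvd a \<Longrightarrow> e dvd b \<Longrightarrow> f (d * e) = f d * f e"
  shows "(\<Sum>d | d dvd a * b. f d) = (\<Sum>d | d dvd a. f d) * (\<Sum>e | e dvd b. f e)"
proof -
  have "(\<Sum>d | d dvd a. f d) * (\<Sum>e | e dvd b. f e)
      = (\<Sum>(d, e)\<in>{d. d dvd a} \<times> {e. e dvd b}. f (d * e))"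
    by (simp add: sum_product sum.cartesian_product) (intro sum.cong, auto simp: f)
  also have "\<dots> = (\<Sum>d | d dvd a * b. f d)"
  proof (rule sum.reindex_bij_witness[of _ "\<lambda>x. (gcd x a, gcd x b)" "\<lambda>(d, e). d * e"], goal_cases)
    case (1 x)
    then obtain d e where x: "x = (d, e)" "d dvd a" "e dvd b" by auto
    have "coprime e a" "coprime d b"
      using coprime_divisors[OF dvd_refl x(3) assms(1)] coprime_divisors[OF x(2) dvd_refl assms(1)]
      by (simp_all add: coprime_commute)
    then have "gcd (d * e) a = gcd d a" "gcd (d * e) b = gcd e b"
      by (metis coprime_commute gcd.commute gcd_mult_right_right_cancel gcd_mult_right_left_cancel)+
    then show ?case using x by (simp add: gcd_nat.absorb1)
  next
    case (3 x)
    have "gcd x (a * b) = gcd x a * gcd x b"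
      using assms(1) by (rule gcd_coprime_mult_right)
    then show ?case using 3 by (simp add: gcd_nat.absorb1)
  qed (auto intro: mult_dvd_mono)
  finally show ?thesis ..
qed

text \<open>Induction on the exponent. As long as the next power of \<open>p\<close> divides
  \<open>h\<close>, the new term is its totient and the sum grows to that power. At the first power
  that does not divide \<open>h\<close>, the new term is minus the sum so far. After that, the
  argument of the Moebius function is divisible by the square of \<open>p\<close> and every term is
  0.\<close>

lemma sum_hoelder_prime_power:
  assumes p: "prime p"
  shows "(\<Sum>d | d dvd p ^ a. hoelder h d) = (if p ^ a dvd h then real (p ^ a) else 0)"
proof -
  have "{d. d dvd p ^ a} = (\<lambda>i. p ^ i) ` {..a}"
    using p by (auto simp: divides_primepow_nat le_imp_power_dvd)
  moreover have "inj_on (\<lambda>i. p ^ i) {..a}"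
    using p prime_gt_1_nat by (auto intro!: inj_onI dest: power_inject_exp[THEN iffD1, rotated])
  ultimately have "(\<Sum>d | d dvd p ^ a. hoelder h d) = (\<Sum>i\<le>a. hoelder h (p ^ i))"
    by (simp add: sum.reindex)
  also have "\<dots> = (if p ^ a dvd h then real (p ^ a) else 0)"
  proof (induction a)
    case 0
    then show ?case by (simp add: hoelder_def)
  next
    case (Suc a)
    have p0: "p > 0" "p > 1" using p prime_gt_0_nat prime_gt_1_nat by auto
    obtain c where c: "gcd h (p ^ Suc a) = p ^ c" "c \<le> Suc a"
      using p by (metis divides_primepow_nat gcd_dvd2)
    \<comment> \<open>The exponent \<open>c\<close> records how often \<open>p\<close> divides
      \<open>h\<close>, capped at \<open>Suc a\<close>; hence the bound on \<open>b\<close>.\<close>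
    have dvd_iff: "p ^ b dvd h \<longleftrightarrow> b \<le> c" if "b \<le> Suc a" for b
    proof -
      have "p ^ b dvd h \<longleftrightarrow> p ^ b dvd gcd h (p ^ Suc a)"
        using that le_imp_power_dvd by (metis gcd_greatest_iff)
      then show ?thesis using c p0 by (metis power_dvd_imp_le le_imp_power_dvd)
    qed
    have div: "p ^ Suc a div p ^ c = p ^ (Suc a - c)"
      using c p0 by (simp only: power_diff)
    have phi: "real (totient (p ^ Suc a)) = real p ^ a * (real p - 1)"
      using p p0 by (simp add: totient_prime_power_Suc of_nat_diff del: power_Suc)
    consider "c = Suc a" | "c = a" | "c < a" using c(2) by linarith
    then show ?case
    proof cases
      case 1
      then show ?thesis
        using dvd_iff[of a] dvd_iff[of "Suc a"] Suc p0 c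
        by (simp add: hoelder_def phi algebra_simps del: power_Suc) (simp add: algebra_simps)
    next
      case 2
      have "hoelder h (p ^ Suc a) = - (real p ^ a)"
        unfolding hoelder_def c(1) div phi using 2 p p0
        by (simp add: moebius_prime totient_prime of_nat_diff)
      then show ?thesis using dvd_iff[of a] dvd_iff[of "Suc a"] Suc 2
        by (simp del: power_Suc)
    next
      case 3
      have "p ^ 2 dvd p ^ (Suc a - c)" using 3 by (intro le_imp_power_dvd) simp
      then have "moebius (p ^ (Suc a - c)) = 0"
        using p0 by (intro moebius_eq_0[of p]) simp_all
      then have "hoelder h (p ^ Suc a) = 0"
        unfolding hoelder_def c(1) div by simp
      then show ?thesis using dvd_iff[of a] dvd_iff[of "Suc a"] Suc 3
        by (simp del: power_Suc)
    qed
  qed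
  finally show ?thesis .
qed

text \<open>Splitting off the full power of one prime leaves a smaller coprime cofactor, and the
  divisor sum of a multiplicative function is multiplicative. The right-hand side is the sum of the
  \<open>h\<close>-th powers of all \<open>m\<close>-th roots of unity, which is what allows the
  comparison with Ramanujan sums.\<close>

lemma sum_hoelder:
  assumes "m > 0"
  shows "(\<Sum>d | d dvd m. hoelder h d) = (if m dvd h then real m else 0)"
  using assms
proof (induction m rule: less_induct)
  case (less m)
  show ?case
  proof (cases "m = 1")
    case True
    then show ?thesis by (simp add: hoelder_def)
  next
    case False
    then obtain p where p: "prime p" "p dvd m" by (meson prime_factor_nat)
    have "m \<noteq> 0" "\<not> is_unit p" using less.prems p by auto
    then obtain b where b: "m = p ^ multiplicity p m * b" "\<not> p dvd b"
      by (rule multiplicity_decompose')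
    define k where "k = multiplicity p m"
    have m: "m = p ^ k * b" using b k_def by simp
    have "k > 0" using p \<open>m \<noteq> 0\<close> by (simp add: k_def prime_multiplicity_gt_zero_iff)
    then have "p ^ k > 1" using p prime_gt_1_nat by (metis one_less_power)
    have "b > 0" using less.prems m by (auto intro: Nat.gr0I)
    have cop: "coprime (p ^ k) b" using prime_imp_coprime[OF p(1) b(2)] by simp
    have "b < m" using \<open>p ^ k > 1\<close> \<open>b > 0\<close> m by simp
    have "(\<Sum>d | d dvd m. hoelder h d) =
        (\<Sum>d | d dvd p ^ k. hoelder h d) * (\<Sum>d | d dvd b. hoelder h d)"
      unfolding m
    proof (rule sum_divisors_coprime_mult)
      fix d e assume de: "d dvd p ^ k" "e dvd b"
      show "hoelder h (d * e) = hoelder h d * hoelder h e"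
      proof (rule hoelder_mult_coprime)
        show "coprime d e" using coprime_divisors[OF de cop] .
        show "d > 0" "e > 0"
          using dvd_pos_nat[OF _ de(1)] dvd_pos_nat[OF _ de(2)] \<open>b > 0\<close> \<open>p ^ k > 1\<close>
          by linarith+
      qed
    qed (use cop \<open>b > 0\<close> p prime_gt_0_nat in auto)
    also have "\<dots> = (if p ^ k dvd h then real (p ^ k) else 0) * (if b dvd h then real b else 0)"
      using sum_hoelder_prime_power[OF p(1)] less.IH[OF \<open>b < m\<close> \<open>b > 0\<close>] by simp
    also have "\<dots> = (if m dvd h then real m else 0)"
    proof -
      have "m dvd h \<longleftrightarrow> p ^ k dvd h \<and> b dvd h"
        using cop m by (metis divides_mult dvd_mult_left dvd_mult_right)
      moreover have "real m = real (p ^ k) * real b" by (metis m of_nat_mult)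
      ultimately show ?thesis by simp
    qed
    finally show ?thesis .
  qed
qed

section \<open>Cosine sums and Ramanujan sums\<close>

text \<open>Usually written with complex exponentials; the sines cancel under the substitution of
  \<open>m - k\<close> for \<open>k\<close>, so the cosines give the whole sum.\<close>

definition ramanujan_sum :: "nat \<Rightarrow> nat \<Rightarrow> real"
  where "ramanujan_sum m h = (\<Sum>k\<in>totatives m. cos (2 * pi * real h * real k / real m))"

text \<open>The \<open>k\<close> with \<open>gcd k n = r\<close> are exactly the multiples
  \<open>j * r\<close> with \<open>j\<close> a totative of \<open>n div r\<close>.\<close>

lemma sum_by_gcd:
  fixes n :: nat
  assumes "n > 0"
  shows "(\<Sum>k\<in>{0<..n}. f k) = (\<Sum>r | r dvd n. \<Sum>j\<in>totatives (n div r). f (j * r))"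
proof -
  have "(\<Sum>k\<in>{0<..n}. f k) = (\<Sum>r | r dvd n. \<Sum>k\<in>{k \<in> {0<..n}. gcd k n = r}. f k)"
    using assms by (intro sum.group[symmetric]) auto
  also have "\<dots> = (\<Sum>r | r dvd n. \<Sum>j\<in>totatives (n div r). f (j * r))"
    using assms by (intro sum.cong sum.reindex_bij_betw[symmetric] bij_betw_totatives_gcd_eq) auto
  finally show ?thesis .
qed

text \<open>A geometric series whose ratio \<open>z\<close> is an \<open>n\<close>-th root of unity:
  it vanishes unless \<open>z = 1\<close>.\<close>

lemma sum_cis_eq:
  assumes "n > 0"
  shows "(\<Sum>k<n. cis (2 * pi * real h * real k / real n)) = (if n dvd h then of_nat n else 0)"
proof -
  define z where "z = cis (2 * pi * real h / real n)"
  have z: "cis (2 * pi * real h * real k / real n) = z ^ k" for k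
    by (simp add: z_def DeMoivre mult_ac)
  have zn: "z ^ n = 1"
    using assms z[of n] cis_multiple_2pi[of "real h"] by (simp add: mult_ac)
  have "z = 1 \<longleftrightarrow> n dvd h"
  proof
    assume "z = 1"
    then have "cos (2 * pi * real h / real n) = 1" by (simp add: z_def complex_eq_iff)
    then obtain x :: int where "2 * pi * real h / real n = of_int x * 2 * pi"
      by (auto simp: cos_one_2pi_int)
    then have "real h = of_int x * real n" using assms by (simp add: field_simps)
    then have "int h = x * int n" by (metis of_int_eq_iff of_int_mult of_int_of_nat_eq)
    then show "n dvd h" by (metis dvd_triv_right int_dvd_int_iff)
  next
    assume "n dvd h"
    then obtain x where "h = n * x" by auto
    then show "z = 1"
      using assms cis_multiple_2pi[of "real x"] by (simp add: z_def mult_ac)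
  qed
  then show ?thesis
    using zn by (cases "z = 1") (simp_all add: z geometric_sum)
qed

text \<open>For \<open>k = j * r\<close> the fraction \<open>k / n\<close> reduces to
  \<open>j / (n div r)\<close>, so each gcd class yields one Ramanujan sum. The weight
  \<open>w\<close> will be the number of monomials fixed by a rotation, which depends only on the
  gcd.\<close>

lemma sum_cos_gcd:
  fixes w :: "nat \<Rightarrow> real"
  assumes "n > 0"
  shows "(\<Sum>k<n. cos (2 * pi * real h * real k / real n) * w (gcd k n))
    = (\<Sum>r | r dvd n. ramanujan_sum (n div r) h * w r)"
proof -
  define f where "f k = cos (2 * pi * real h * real k / real n) * w (gcd k n)" for k
  \<comment> \<open>The index 0 is traded for \<open>n\<close>, which has the same cosine and the
    same gcd with \<open>n\<close>, because totatives are counted from 1.\<close>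
  have "f n = f 0" using assms cos_2npi[of h] by (simp add: f_def mult_ac)
  then have "(\<Sum>k<n. f k) = (\<Sum>k<n. f (Suc k))"
    using sum.lessThan_Suc_shift[of f n] by simp
  also have "\<dots> = (\<Sum>k\<in>{0<..n}. f k)"
    using sum.atLeast1_atMost_eq[of f n] by (simp add: atLeastSucAtMost_greaterThanAtMost)
  also have "\<dots> = (\<Sum>r | r dvd n. \<Sum>j\<in>totatives (n div r). f (j * r))"
    using assms by (rule sum_by_gcd)
  also have "\<dots> = (\<Sum>r | r dvd n. ramanujan_sum (n div r) h * w r)"
  proof (intro sum.cong refl)
    fix r assume "r \<in> {r. r dvd n}"
    then obtain q where q: "n = r * q" by auto
    then have pos: "r > 0" "q > 0" using assms by auto
    have "f (j * r) = cos (2 * pi * real h * real j / real q) * w r" if "j \<in> totatives q" for j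
    proof -
      have "gcd (j * r) n = r * gcd j q"
        unfolding q using gcd_mult_distrib_nat[of r j q] by (simp add: mult.commute)
      then have "gcd (j * r) n = r" using that by (simp add: in_totatives_iff)
      then show ?thesis using pos by (simp add: f_def q mult.assoc)
    qed
    then show "(\<Sum>j\<in>totatives (n div r). f (j * r)) = ramanujan_sum (n div r) h * w r"
      using pos by (simp add: q ramanujan_sum_def sum_distrib_right)
  qed
  finally show ?thesis by (simp add: f_def)
qed

text \<open>With constant weight 1, grouping by gcd reassembles the sum over all \<open>n\<close>-th
  roots of unity.\<close>

lemma sum_ramanujan_sum:
  assumes "n > 0"
  shows "(\<Sum>d | d dvd n. ramanujan_sum d h) = (if n dvd h then real n else 0)"
proof -
  have "(\<Sum>d | d dvd n. ramanujan_sum d h) = (\<Sum>r | r dvd n. ramanujan_sum (n div r) h)"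
    using assms by (intro sum.reindex_bij_witness[of _ "(div) n" "(div) n"]) (auto elim: dvdE)
  also have "\<dots> = (\<Sum>k<n. cos (2 * pi * real h * real k / real n))"
    using sum_cos_gcd[OF assms, of h "\<lambda>_. 1"] by simp
  also have "\<dots> = Re (\<Sum>k<n. cis (2 * pi * real h * real k / real n))"
    by simp
  finally show ?thesis using sum_cis_eq[OF assms, of h] by simp
qed

text \<open>Both functions have the same divisor sums. Strong induction removes the proper divisors
  and leaves equality at \<open>m\<close>; this is the uniqueness behind Moebius inversion.\<close>

theorem ramanujan_sum_eq_hoelder:
  assumes "m > 0"
  shows "ramanujan_sum m h = hoelder h m"
  using assms
proof (induction m rule: less_induct)
  case (less m)
  have split: "(\<Sum>d | d dvd m. f d) = f m + (\<Sum>d | d dvd m \<and> d \<noteq> m. f d)" for f :: "nat \<Rightarrow> real"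
  proof -
    have "{d. d dvd m} = insert m {d. d dvd m \<and> d \<noteq> m}" by auto
    moreover have "finite {d. d dvd m \<and> d \<noteq> m}" using less.prems by simp
    ultimately show ?thesis by (simp add: sum.insert)
  qed
  have "(\<Sum>d | d dvd m \<and> d \<noteq> m. ramanujan_sum d h) = (\<Sum>d | d dvd m \<and> d \<noteq> m. hoelder h d)"
  proof (intro sum.cong refl less.IH)
    fix d assume "d \<in> {d. d dvd m \<and> d \<noteq> m}"
    then show "d < m" "d > 0"
      using less.prems dvd_imp_le[of d m] dvd_pos_nat[of m d] by simp_all
  qed
  then show ?case
    using split[of "\<lambda>d. ramanujan_sum d h"] split[of "hoelder h"]
      sum_ramanujan_sum[OF less.prems, of h] sum_hoelder[OF less.prems, of h] by simp
qed

section \<open>Counting fixed monomials\<close>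

lemma monom_degree_eq_sum:
  assumes "Poly_Mapping.keys m \<subseteq> {1..n}"
  shows "monom_degree m = (\<Sum>i<n. Poly_Mapping.lookup m (Suc i))"
proof -
  have "monom_degree m = (\<Sum>i\<in>{1..n}. Poly_Mapping.lookup m i)"
    unfolding monom_degree_def using assms
    by (intro sum.mono_neutral_left) (auto simp: in_keys_iff)
  then show ?thesis by (simp add: sum.atLeast1_atMost_eq)
qed

text \<open>The range is cut into \<open>q\<close> blocks of length \<open>r\<close>, on each of
  which \<open>i mod r\<close> runs through all residues.\<close>

lemma sum_mod_blocks:
  fixes f :: "nat \<Rightarrow> 'a::comm_semiring_1"
  shows "(\<Sum>i<q * r. f (i mod r)) = of_nat q * (\<Sum>i<r. f i)"
proof -
  have "sum (\<lambda>i. f (i mod r)) {k * r..<k * r + r} = (\<Sum>i<r. f i)" for k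
    using sum.shift_bounds_nat_ivl[of "\<lambda>i. f (i mod r)" 0 "k * r" r]
    by (simp add: add.commute atLeast0LessThan)
  then show ?thesis using sum.nat_group[of "\<lambda>i. f (i mod r)" r q] by simp
qed

definition periodic_monoms :: "nat \<Rightarrow> nat \<Rightarrow> nat \<Rightarrow> monom set"
  where "periodic_monoms n d r = {m. Poly_Mapping.keys m \<subseteq> {1..n} \<and> monom_degree m = d
    \<and> (\<forall>i<n. Poly_Mapping.lookup m (Suc i) = Poly_Mapping.lookup m (Suc (i mod r)))}"

lemma periodic_monomsD:
  assumes "m \<in> periodic_monoms n d r"
  shows "Poly_Mapping.keys m \<subseteq> {1..n}" "monom_degree m = d"
    "\<And>i. i < n \<Longrightarrow> Poly_Mapping.lookup m (Suc i) = Poly_Mapping.lookup m (Suc (i mod r))"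
  using assms unfolding periodic_monoms_def by blast+

text \<open>The first \<open>r\<close> exponents determine the monomial, and each of them occurs
  \<open>n div r\<close> times, which gives the factor in the degree condition.\<close>

lemma periodic_monoms_bij:
  assumes "n > 0" "r dvd n"
  shows "bij_betw (\<lambda>m. map (\<lambda>i. Poly_Mapping.lookup m (Suc i)) [0..<r])
    (periodic_monoms n d r) {l. length l = r \<and> n div r * sum_list l = d}"
proof -
  \<comment> \<open>The inverse map repeats a list around the \<open>n\<close> variables; the value
    0 elsewhere ensures finite support.\<close>
  define periodic where
    "periodic l i = (if i \<in> {1..n} then l ! ((i - 1) mod r) else 0)" for l :: "nat list" and i
  define of_list where "of_list l = Abs_poly_mapping (periodic l)" for l
  have "finite {i. periodic l i \<noteq> 0}" for l
    by (rule finite_subset[of _ "{1..n}"]) (auto simp: periodic_def)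
  then have lookup: "Poly_Mapping.lookup (of_list l) i = periodic l i" for l i
    by (simp add: of_list_def lookup_Abs_poly_mapping)
  obtain q where q: "n = q * r" using assms by (metis dvd_div_mult_self)
  then have r: "r > 0" "r \<le> n" "n div r = q" using assms by (auto simp: dvd_imp_le)
  have sum_eq: "(\<Sum>i<n. f (i mod r)) = q * (\<Sum>i<r. f i)" for f :: "nat \<Rightarrow> nat"
    using sum_mod_blocks[of f r q] q by simp
  have keys: "Poly_Mapping.keys (of_list l) \<subseteq> {1..n}" for l
    by (auto simp: in_keys_iff lookup periodic_def split: if_splits)
  show ?thesis
  proof (rule bij_betw_byWitness[where f' = of_list])
    show "\<forall>m\<in>periodic_monoms n d r.
        of_list (map (\<lambda>i. Poly_Mapping.lookup m (Suc i)) [0..<r]) = m"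
    proof (intro ballI poly_mapping_eqI)
      fix m i assume m: "m \<in> periodic_monoms n d r"
      show "Poly_Mapping.lookup (of_list (map (\<lambda>i. Poly_Mapping.lookup m (Suc i)) [0..<r])) i
          = Poly_Mapping.lookup m i"
      proof (cases "i \<in> {1..n}")
        case True
        then obtain j where "i = Suc j" "j < n" by (cases i) auto
        then show ?thesis using periodic_monomsD(3)[OF m, of j] r
            by (simp add: lookup periodic_def)
      next
        case False
        then have "i \<notin> Poly_Mapping.keys m" using periodic_monomsD(1)[OF m] by blast
        then have "Poly_Mapping.lookup m i = 0" by (simp add: in_keys_iff)
        then show ?thesis using False by (auto simp: lookup periodic_def)
      qed
    qed
    show "\<forall>l\<in>{l. length l = r \<and> n div r * sum_list l = d}.
        map (\<lambda>i. Poly_Mapping.lookup (of_list l) (Suc i)) [0..<r] = l"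
      using r by (auto intro!: nth_equalityI simp: lookup periodic_def)
    show "(\<lambda>m. map (\<lambda>i. Poly_Mapping.lookup m (Suc i)) [0..<r]) ` periodic_monoms n d r
        \<subseteq> {l. length l = r \<and> n div r * sum_list l = d}"
    proof (rule image_subsetI)
      fix m assume "m \<in> periodic_monoms n d r"
      note m = periodic_monomsD[OF this]
      have "d = (\<Sum>i<n. Poly_Mapping.lookup m (Suc i))"
        using monom_degree_eq_sum[OF m(1)] m(2) by simp
      also have "\<dots> = (\<Sum>i<n. Poly_Mapping.lookup m (Suc (i mod r)))"
        by (intro sum.cong refl) (rule m(3), simp)
      also have "\<dots> = q * (\<Sum>i<r. Poly_Mapping.lookup m (Suc i))"
        by (rule sum_eq)
      finally show "map (\<lambda>i. Poly_Mapping.lookup m (Suc i)) [0..<r]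
          \<in> {l. length l = r \<and> n div r * sum_list l = d}"
        by (simp add: r(3) interv_sum_list_conv_sum_set_nat atLeast0LessThan)
    qed
    show "of_list ` {l. length l = r \<and> n div r * sum_list l = d} \<subseteq> periodic_monoms n d r"
    proof (rule image_subsetI)
      fix l assume l: "l \<in> {l. length l = r \<and> n div r * sum_list l = d}"
      have "monom_degree (of_list l) = (\<Sum>i<n. l ! (i mod r))"
        by (simp add: monom_degree_eq_sum[OF keys] lookup periodic_def)
      also have "\<dots> = q * (\<Sum>i<r. l ! i)"
        by (rule sum_eq)
      also have "\<dots> = d"
        using l by (auto simp: r(3) sum_list_sum_nth atLeast0LessThan)
      finally have "monom_degree (of_list l) = d" .
      moreover have "i mod r < n" for i using r mod_less_divisor[of r i] by linarith
      ultimately show "of_list l \<in> periodic_monoms n d r"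
        using keys by (simp add: periodic_monoms_def lookup periodic_def Suc_le_eq)
    qed
  qed
qed

lemma finite_periodic_monoms:
  assumes "n > 0" "r dvd n"
  shows "finite (periodic_monoms n d r)"
proof -
  have "n div r > 0" using assms by (auto elim!: dvdE)
  have "set l \<subseteq> {..d}" if "n div r * sum_list l = d" for l
  proof
    fix x assume "x \<in> set l"
    then have "x \<le> sum_list l" by (simp add: member_le_sum_list)
    also have "\<dots> \<le> n div r * sum_list l" using \<open>n div r > 0\<close> by simp
    finally show "x \<in> {..d}" using that by simp
  qed
  then have "{l. length l = r \<and> n div r * sum_list l = d} \<subseteq> {l. set l \<subseteq> {..d} \<and> length l = r}"
    by blast
  then have "finite {l. length l = r \<and> n div r * sum_list l = d}"
    by (rule finite_subset) (rule finite_lists_length_eq, simp)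
  then show ?thesis using bij_betw_finite[OF periodic_monoms_bij[OF assms]] by blast
qed

text \<open>The number of monomials of degree \<open>d\<close> fixed by a permutation with \<open>r\<close> cycles, all of length \<open>m\<close>.\<close>

definition cycle_count :: "nat \<Rightarrow> nat \<Rightarrow> nat \<Rightarrow> nat"
  where "cycle_count r m d = (if m dvd d then (r + d div m - 1) choose (r - 1) else 0)"

text \<open>Stars and bars for lists of length \<open>r\<close> whose sum is \<open>d\<close>
  divided by the cycle length; without divisibility there are no such lists.\<close>

lemma card_periodic_monoms:
  assumes "n > 0" "r dvd n"
  shows "card (periodic_monoms n d r) = cycle_count r (n div r) d"
proof -
  have pos: "n div r > 0" "r > 0" using assms by (auto elim!: dvdE)
  have "card (periodic_monoms n d r) = card {l. length l = r \<and> n div r * sum_list l = d}"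
    by (rule bij_betw_same_card) (rule periodic_monoms_bij[OF assms])
  also have "\<dots> = cycle_count r (n div r) d"
  proof (cases "n div r dvd d")
    case True
    then have "n div r * sum_list l = d \<longleftrightarrow> sum_list l = d div (n div r)" for l
      using pos by auto
    then have "card {l. length l = r \<and> n div r * sum_list l = d}
        = (d div (n div r) + r - 1) choose (d div (n div r))"
      using card_length_sum_list[of r "d div (n div r)"] by simp
    also have "\<dots> = (r + d div (n div r) - 1) choose (r - 1)"
      using pos by (subst binomial_symmetric) (auto simp: add.commute)
    finally show ?thesis using True by (simp add: cycle_count_def)
  next
    case False
    then have "{l. length l = r \<and> n div r * sum_list l = d} = {}" by auto
    then show ?thesis using False by (simp only: cycle_count_def if_False card.empty)
  qed
  finally show ?thesis .
qed

section \<open>Generating functions and the extended binomial coefficient\<close>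

text \<open>The negative binomial series for exponent \<open>r\<close>, composed with
  \<open>fps_X ^ m\<close>, keeps its coefficients at the multiples of \<open>m\<close> and is 0
  elsewhere.\<close>

lemma nth_inverse_one_minus_X_power:
  fixes d :: nat
  assumes "m > 0" "r > 0"
  shows "inverse ((1 - fps_X ^ m :: 'a::field_char_0 fps) ^ r) $ d = of_nat (cycle_count r m d)"
proof -
  have "inverse ((1 - fps_X ^ m :: 'a fps) ^ r) = inverse ((1 - fps_X) ^ r) oo fps_X ^ m"
    using assms
    by (simp add: fps_inverse_compose fps_compose_power[symmetric] fps_compose_sub_distrib)
  also have "\<dots> $ d = (if m dvd d then inverse ((1 - fps_X :: 'a fps) ^ r) $ (d div m) else 0)"
    by (rule fps_nth_compose_X_power)
  also have "inverse ((1 - fps_X :: 'a fps) ^ r) $ k = of_nat ((r + k - 1) choose k)" for k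
    using one_minus_const_fps_X_neg_power'[OF assms(2), of "1::'a"] by simp
  also have "(r + k - 1) choose k = (r + k - 1) choose (r - 1)" for k
    using assms by (subst binomial_symmetric) auto
  finally show ?thesis by (simp add: cycle_count_def)
qed

text \<open>The upper argument is a natural number exactly when the cycle length divides
  \<open>d\<close>, so the default value 0 of \<open>binom\<close> matches the zero branch of
  \<open>cycle_count\<close>.\<close>

lemma binom_eq_cycle_count:
  assumes "n > 0" "r dvd n"
  shows "binom (real r + real d / (real n / real r) - 1) (real r - 1)
    = real (cycle_count r (n div r) d)"
proof -
  obtain m where n: "n = r * m" using assms by auto
  then have pos: "r > 0" "m > 0" using assms by auto
  define x where "x = real r + real d / real m - 1"
  have x: "real r + real d / (real n / real r) - 1 = x"
    using n pos by (simp add: x_def)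
  have r: "real r - 1 = real (r - 1)" using pos by simp
  have x_nat: "x = real (r + d div m - 1)" if "m dvd d"
    using that pos by (auto simp: x_def of_nat_diff elim!: dvdE)
  have "x \<in> \<nat> \<longleftrightarrow> m dvd d"
  proof
    assume "x \<in> \<nat>"
    then obtain k where "x = real k" by (auto elim: Nats_cases)
    then have "real d = (real k + 1 - real r) * real m"
      using pos by (simp add: x_def field_simps)
    then have "real_of_int (int d) = real_of_int ((int k + 1 - int r) * int m)" by simp
    then have "int d = (int k + 1 - int r) * int m" by (simp only: of_int_eq_iff)
    then show "m dvd d" by (metis dvd_triv_right int_dvd_int_iff)
  qed (use x_nat in simp)
  moreover have "n div r = m" using n pos by simp
  ultimately show ?thesis
    unfolding x r by (cases "m dvd d") (simp_all add: binom_def cycle_count_def x_nat)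
qed

section \<open>Monomials fixed by a rotation\<close>

lemma bij_rotation_pow:
  assumes "n > 0"
  shows "bij (rotation n ^^ k)"
proof -
  have "rotation n ^^ n = id"
    using rotation_pow_eq_iff[OF assms, of n 0] by simp
  then have "rotation n ^^ (n - 1) \<circ> rotation n = id" "rotation n \<circ> rotation n ^^ (n - 1) = id"
    using assms by (metis Suc_diff_1 funpow_Suc_right, metis Suc_diff_1 funpow.simps(2))
  then have "bij (rotation n)" by (rule o_bij)
  then show ?thesis by (rule bij_fn)
qed

lemma rotation_Suc: "i < n \<Longrightarrow> (rotation n ^^ k) (Suc i) = Suc ((i + k) mod n)"
  by (simp add: rotation_apply)

text \<open>A fixed exponent vector, read cyclically, has the periods \<open>k\<close> and
  \<open>n\<close>, hence by Bezout the period \<open>gcd k n\<close>; the converse holds because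
  the gcd divides both.\<close>

lemma perm_monom_rotation_fixed:
  assumes "n > 0"
  shows "{m \<in> periodic_monoms n d n. perm_monom (rotation n ^^ k) m = m}
    = periodic_monoms n d (gcd k n)"
proof -
  define r where "r = gcd k n"
  have r: "r > 0" "r \<le> n" "r dvd n" "r dvd k"
    using assms by (auto simp: r_def gcd_le2_nat)
  have "perm_monom (rotation n ^^ k) m = m \<longleftrightarrow>
      (\<forall>i<n. Poly_Mapping.lookup m (Suc i) = Poly_Mapping.lookup m (Suc (i mod r)))" for m
  proof -
    have fixed_iff: "perm_monom (rotation n ^^ k) m = m \<longleftrightarrow>
        (\<forall>i. Poly_Mapping.lookup m ((rotation n ^^ k) i) = Poly_Mapping.lookup m i)"
      unfolding perm_monom_eq by (rule pushforward_fixed_iff[OF bij_rotation_pow[OF assms]])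
    show ?thesis
    proof
      assume *: "perm_monom (rotation n ^^ k) m = m"
      \<comment> \<open>The exponents are extended \<open>n\<close>-periodically to all naturals, so
        that shifts need no reduction.\<close>
      define u where "u i = Poly_Mapping.lookup m (Suc (i mod n))" for i
      have u_k: "u (i + k) = u i" for i
        using * assms rotation_Suc[of "i mod n" n k]
        unfolding fixed_iff u_def by (metis mod_add_left_eq mod_less_divisor)
      have u_ky: "u (i + k * y) = u i" for i y
      proof (induction y)
        case (Suc y)
        then show ?case using u_k[of "i + k * y"] by (simp add: algebra_simps)
      qed simp
      \<comment> \<open>Bezout without subtraction: a shift by \<open>r\<close> followed by
        \<open>y\<close> shifts by \<open>k\<close> is a shift by a multiple of
        \<open>n\<close>.\<close>
      obtain x y where xy: "n * x = k * y + r"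
        using bezout_nat[of n k] assms by (auto simp: r_def gcd.commute)
      have u_r: "u (i + r) = u i" for i
      proof -
        have "u (i + r) = u (i + r + k * y)" by (rule u_ky[symmetric])
        also have "i + r + k * y = i + n * x" using xy by simp
        also have "u \<dots> = u i" by (simp add: u_def)
        finally show ?thesis .
      qed
      have u_rz: "u (i + r * z) = u i" for i z
      proof (induction z)
        case (Suc z)
        then show ?case using u_r[of "i + r * z"] by (simp add: algebra_simps)
      qed simp
      show "\<forall>i<n. Poly_Mapping.lookup m (Suc i) = Poly_Mapping.lookup m (Suc (i mod r))"
      proof (intro allI impI)
        fix i assume "i < n"
        moreover have "i mod r < n" using r mod_less_divisor[of r i] by linarith
        moreover have "u i = u (i mod r)" using u_rz[of "i mod r" "i div r"] by simp
        ultimately show "Poly_Mapping.lookup m (Suc i) = Poly_Mapping.lookup m (Suc (i mod r))"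
          by (simp add: u_def)
      qed
    next
      assume *: "\<forall>i<n. Poly_Mapping.lookup m (Suc i) = Poly_Mapping.lookup m (Suc (i mod r))"
      show "perm_monom (rotation n ^^ k) m = m"
        unfolding fixed_iff
      proof
        fix i
        show "Poly_Mapping.lookup m ((rotation n ^^ k) i) = Poly_Mapping.lookup m i"
        proof (cases "i \<in> {1..n}")
          case True
          then obtain j where j: "i = Suc j" "j < n" by (cases i) auto
          have "(j + k) mod n mod r = j mod r"
            using r by (metis add.right_neutral dvd_imp_mod_0 mod_add_right_eq mod_mod_cancel)
          then have "Poly_Mapping.lookup m (Suc ((j + k) mod n)) = Poly_Mapping.lookup m (Suc j)"
            using *[rule_format, of "(j + k) mod n"] *[rule_format, of j] j assms by simp
          then show ?thesis using j rotation_Suc[of j n k] by simp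
        qed (simp add: rotation_outside)
      qed
    qed
  qed
  then show ?thesis by (auto simp: periodic_monoms_def r_def)
qed

lemma hom_polys_eq: "hom_polys n d = {p. Poly_Mapping.keys p \<subseteq> periodic_monoms n d n}"
  by (auto simp: hom_polys_def periodic_monoms_def)

lemma keys_pushforward_subset: "Poly_Mapping.keys (pushforward f p) \<subseteq> f ` Poly_Mapping.keys p"
  using Poly_Mapping.keys_sum[of "\<lambda>i. Poly_Mapping.single (f i) (Poly_Mapping.lookup p i)"
      "Poly_Mapping.keys p"]
  by (auto simp: pushforward_def split: if_splits)

lemma monom_degree_perm_monom:
  assumes "inj g"
  shows "monom_degree (perm_monom g m) = monom_degree m"
proof -
  have "monom_degree (perm_monom g m)
      = (\<Sum>j\<in>g ` Poly_Mapping.keys m. Poly_Mapping.lookup (perm_monom g m) j)"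
    unfolding monom_degree_def perm_monom_eq using keys_pushforward_subset[of g m]
    by (intro sum.mono_neutral_left) (auto simp: in_keys_iff)
  also have "\<dots> = monom_degree m"
    using assms by (simp add: sum.reindex inj_on_subset perm_monom_eq lookup_pushforward monom_degree_def)
  finally show ?thesis .
qed

lemma perm_poly_rotation_hom_polys:
  assumes "n > 0" "p \<in> hom_polys n d"
  shows "perm_poly (rotation n ^^ k) p \<in> hom_polys n d"
  unfolding hom_polys_def
proof (intro CollectI ballI)
  fix m assume "m \<in> Poly_Mapping.keys (perm_poly (rotation n ^^ k) p)"
  then obtain m' where m': "m' \<in> Poly_Mapping.keys p" "m = perm_monom (rotation n ^^ k) m'"
    unfolding perm_poly_eq
    using keys_pushforward_subset[of "perm_monom (rotation n ^^ k)" p] by blast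
  have "Poly_Mapping.keys m' \<subseteq> {1..n}" "monom_degree m' = d"
    using assms(2) m'(1) by (auto simp: hom_polys_def)
  moreover have "(rotation n ^^ k) ` {1..n} \<subseteq> {1..n}"
    using assms(1) by (auto simp: rotation_apply Suc_le_eq)
  moreover have "Poly_Mapping.keys m \<subseteq> (rotation n ^^ k) ` Poly_Mapping.keys m'"
    unfolding m'(2) perm_monom_eq by (rule keys_pushforward_subset)
  moreover have "monom_degree m = monom_degree m'"
    unfolding m'(2) using bij_rotation_pow[OF assms(1)]
    by (intro monom_degree_perm_monom) (rule bij_is_inj)
  ultimately show "Poly_Mapping.keys m \<subseteq> {1..n} \<and> monom_degree m = d"
    by (metis image_mono order.trans)
qed

section \<open>The symmetrising operator of the dihedral group\<close>

text \<open>The \<open>2 * n\<close> listed elements are distinct: rotations by their values,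
  reflections because \<open>reversal\<close> is an involution, and the two kinds are
  disjoint.\<close>

lemma sum_dihedral:
  assumes "n \<ge> 3"
  shows "(\<Sum>g\<in>dihedral n. f g)
    = (\<Sum>k<n. f (rotation n ^^ k)) + (\<Sum>k<n. f (reversal n \<circ> rotation n ^^ k))"
proof -
  have inj: "inj_on (\<lambda>k. rotation n ^^ k) {..<n}"
    using assms by (auto simp: inj_on_def rotation_pow_eq_iff)
  have "reversal n \<circ> reversal n = id" by (auto simp: reversal_def fun_eq_iff)
  then have "reversal n \<circ> f = reversal n \<circ> g \<longleftrightarrow> f = g" for f g :: "nat \<Rightarrow> nat"
    by (metis comp_assoc id_comp)
  with inj have inj': "inj_on (\<lambda>k. reversal n \<circ> rotation n ^^ k) {..<n}"
    by (simp add: inj_on_def)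
  \<comment> \<open>Evaluating \<open>dihedral_char\<close> at \<open>h = 0\<close> separates the
    kinds: it is 2 on rotations and 0 on reflections.\<close>
  have "rotation n ^^ k \<noteq> reversal n \<circ> rotation n ^^ l" for k l
    using dihedral_char_rotation[of n 0 k] dihedral_char_reflection[OF assms, of 0 l] assms by auto
  then have "(\<lambda>k. rotation n ^^ k) ` {..<n} \<inter> (\<lambda>k. reversal n \<circ> rotation n ^^ k) ` {..<n} = {}"
    by blast
  moreover have "dihedral n
      = (\<lambda>k. rotation n ^^ k) ` {..<n} \<union> (\<lambda>k. reversal n \<circ> rotation n ^^ k) ` {..<n}"
    by (auto simp: dihedral_def)
  ultimately show ?thesis
    using inj inj' by (simp add: sum.union_disjoint sum.reindex)
qed

lemma card_dihedral: "n \<ge> 3 \<Longrightarrow> card (dihedral n) = 2 * n"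
  using sum_dihedral[of n "\<lambda>_. 1 :: nat"] by simp

text \<open>Reflections drop out since the character vanishes on them, and the prefactor is 2
  divided by the group order \<open>2 * n\<close>.\<close>

lemma sym_operator_dihedral:
  assumes "n \<ge> 3"
  shows "sym_operator (dihedral n) (dihedral_char n h) p = cpoly_scale (1 / of_nat n)
    (\<Sum>k<n. cpoly_scale (of_real (2 * cos (2 * pi * real h * real k / real n)))
      (perm_poly (rotation n ^^ k) p))"
proof -
  have "dihedral_char n h id = 2"
    using dihedral_char_rotation[of n h 0] assms by simp
  moreover have "cpoly_scale 0 q = 0" for q by (rule poly_mapping_eqI) simp
  ultimately show ?thesis
    using assms by (simp add: sym_operator_def sum_dihedral card_dihedral dihedral_char_rotation
        dihedral_char_reflection)
qed

section \<open>Idempotence of the operator\<close>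

lemma sum_shift_periodic:
  fixes g :: "nat \<Rightarrow> 'a::ab_group_add"
  assumes "\<And>j. g (j + n) = g j"
  shows "(\<Sum>l<n. g (k + l)) = (\<Sum>j<n. g j)"
proof (induction k)
  case (Suc k)
  \<comment> \<open>Raising the shift by one drops \<open>g k\<close> and appends
    \<open>g (k + n)\<close>, which are equal.\<close>
  have "(\<Sum>l<n. g (Suc k + l)) + g k = (\<Sum>l<n. g (k + l)) + g (k + n)"
    using sum.lessThan_Suc_shift[of "\<lambda>l. g (k + l)" n] by (simp add: add.commute)
  then show ?case using Suc assms[of k] by simp
qed simp

text \<open>The phase \<open>t\<close> factors out as \<open>cis (- t)\<close> from a vanishing sum
  of roots of unity.\<close>

lemma sum_cos_shifted:
  assumes "n > 0" "\<not> n dvd h"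
  shows "(\<Sum>k<n. cos (2 * pi * real h * real k / real n - t)) = 0"
proof -
  have "(\<Sum>k<n. cos (2 * pi * real h * real k / real n - t))
      = Re ((\<Sum>k<n. cis (2 * pi * real h * real k / real n)) * cis (- t))"
    by (simp add: sum_distrib_right cis_mult)
  then show ?thesis using assms by (simp add: sum_cis_eq)
qed

text \<open>The assumption \<open>\<not> n dvd 2 * h\<close> says that the character is irreducible.\<close>

lemma character_convolution:
  fixes F :: "nat \<Rightarrow> complex"
  assumes n: "n > 0" "\<not> n dvd 2 * h" and F: "\<And>j. F (j + n) = F j"
  defines "\<theta> \<equiv> 2 * pi * real h / real n"
  shows "(\<Sum>k<n. \<Sum>l<n. of_real (2 * cos (\<theta> * real k)) * of_real (2 * cos (\<theta> * real l)) * F (k + l))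
    = of_nat n * (\<Sum>j<n. of_real (2 * cos (\<theta> * real j)) * F j)"
proof -
  \<comment> \<open>Substitute \<open>j = k + l\<close>; the summand has period \<open>n\<close> in
    \<open>j\<close>, so the range may be moved back to \<open>j < n\<close>.\<close>
  have inner: "(\<Sum>l<n. of_real (2 * cos (\<theta> * real l)) * F (k + l))
      = (\<Sum>j<n. of_real (2 * cos (\<theta> * (real j - real k))) * F j)" for k
  proof -
    have "\<theta> * (real (j + n) - real k) = \<theta> * (real j - real k) + 2 * real h * pi" for j
      using n by (simp add: \<theta>_def field_simps)
    then have "cos (\<theta> * (real (j + n) - real k)) = cos (\<theta> * (real j - real k))" for j
      by (simp only: cos_add cos_2npi sin_2npi)
    then show ?thesis
      using sum_shift_periodic[of "\<lambda>j. of_real (2 * cos (\<theta> * (real j - real k))) * F j" n k] F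
      by simp
  qed
  \<comment> \<open>By the product formula each summand splits into
    \<open>2 * cos (\<theta> * real j)\<close>, constant in \<open>k\<close>, and a shifted cosine
    of frequency \<open>2 * h\<close>, which sums to 0 because \<open>n\<close> does not divide
    \<open>2 * h\<close>.\<close>
  have outer: "(\<Sum>k<n. (2 * cos (\<theta> * real k)) * (2 * cos (\<theta> * (real j - real k))))
      = real n * (2 * cos (\<theta> * real j))" for j
  proof -
    have "(2 * cos (\<theta> * real k)) * (2 * cos (\<theta> * (real j - real k)))
        = 2 * cos (\<theta> * real j) + 2 * cos (2 * pi * real (2 * h) * real k / real n - \<theta> * real j)" for k
    proof -
      have "2 * pi * real (2 * h) * real k / real n = 2 * (\<theta> * real k)"
        by (simp add: \<theta>_def)
      then have "\<theta> * real k - \<theta> * (real j - real k) = 2 * pi * real (2 * h) * real k / real n - \<theta> * real j"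
        by (simp only: right_diff_distrib)
      moreover have "\<theta> * real k + \<theta> * (real j - real k) = \<theta> * real j"
        by (simp add: field_simps)
      ultimately show ?thesis
        using cos_times_cos[of "\<theta> * real k" "\<theta> * (real j - real k)"] by simp
    qed
    then have "(\<Sum>k<n. (2 * cos (\<theta> * real k)) * (2 * cos (\<theta> * (real j - real k))))
        = (\<Sum>k<n. 2 * cos (\<theta> * real j))
          + 2 * (\<Sum>k<n. cos (2 * pi * real (2 * h) * real k / real n - \<theta> * real j))"
      by (simp only: sum.distrib sum_distrib_left)
    then show ?thesis using sum_cos_shifted[OF n] by simp
  qed
  have "(\<Sum>k<n. \<Sum>l<n. of_real (2 * cos (\<theta> * real k)) * of_real (2 * cos (\<theta> * real l)) * F (k + l))
      = (\<Sum>k<n. of_real (2 * cos (\<theta> * real k)) * (\<Sum>l<n. of_real (2 * cos (\<theta> * real l)) * F (k + l)))"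
    by (simp only: sum_distrib_left mult.assoc)
  also have "\<dots> = (\<Sum>k<n. \<Sum>j<n.
      of_real ((2 * cos (\<theta> * real k)) * (2 * cos (\<theta> * (real j - real k)))) * F j)"
    by (simp only: inner) (simp only: sum_distrib_left mult.assoc of_real_mult)
  also have "\<dots> = (\<Sum>j<n. \<Sum>k<n.
      of_real ((2 * cos (\<theta> * real k)) * (2 * cos (\<theta> * (real j - real k)))) * F j)"
    by (rule sum.swap)
  also have "\<dots> = (\<Sum>j<n. of_real (\<Sum>k<n. (2 * cos (\<theta> * real k)) * (2 * cos (\<theta> * (real j - real k)))) * F j)"
    by (simp only: sum_distrib_right of_real_sum)
  also have "\<dots> = of_nat n * (\<Sum>j<n. of_real (2 * cos (\<theta> * real j)) * F j)"
    by (simp only: outer) (simp add: sum_distrib_left mult.assoc)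
  finally show ?thesis .
qed

lemma perm_poly_sum: "perm_poly g (sum p S) = (\<Sum>s\<in>S. perm_poly g (p s))"
  by (simp add: perm_poly_eq pushforward_sum)

text \<open>Coefficientwise, applying the operator twice convolves the character with itself over
  the rotations. The convolution returns \<open>n\<close> times the character, which cancels one of
  the two factors \<open>1 / n\<close>.\<close>

lemma sym_operator_dihedral_idem:
  assumes "n \<ge> 3" "\<not> n dvd 2 * h"
  defines "T \<equiv> sym_operator (dihedral n) (dihedral_char n h)"
  shows "T (T p) = T p"
proof (rule poly_mapping_eqI)
  fix m
  define c where "c k = complex_of_real (2 * cos (2 * pi * real h / real n * real k))" for k
  define F where "F k = Poly_Mapping.lookup (perm_poly (rotation n ^^ k) p) m" for k
  have T: "T q = cpoly_scale (1 / of_nat n)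
      (\<Sum>k<n. cpoly_scale (c k) (perm_poly (rotation n ^^ k) q))" for q
    using sym_operator_dihedral[OF assms(1)] by (simp add: T_def c_def)
  have "F (j + n) = F j" for j
    using assms(1) rotation_pow_eq_iff[of n "j + n" j] by (simp add: F_def)
  then have conv: "(\<Sum>k<n. \<Sum>l<n. c k * c l * F (k + l)) = of_nat n * (\<Sum>j<n. c j * F j)"
    unfolding c_def using assms(1,2) by (intro character_convolution) auto
  have "perm_poly (rotation n ^^ k) (T p) = cpoly_scale (1 / of_nat n)
      (\<Sum>l<n. cpoly_scale (c l) (perm_poly (rotation n ^^ (k + l)) p))" for k
    by (simp add: T perm_poly_scale perm_poly_sum perm_poly_perm_poly funpow_add)
  then have "Poly_Mapping.lookup (T (T p)) m
      = 1 / of_nat n * (\<Sum>k<n. c k * (1 / of_nat n * (\<Sum>l<n. c l * F (k + l))))"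
    by (subst T) (simp add: lookup_sum F_def)
  also have "\<dots> = 1 / of_nat n * (1 / of_nat n * (\<Sum>k<n. \<Sum>l<n. c k * c l * F (k + l)))"
    by (simp add: sum_distrib_left mult_ac)
  also have "\<dots> = 1 / of_nat n * (\<Sum>j<n. c j * F j)"
    using assms(1) by (simp add: conv)
  also have "\<dots> = Poly_Mapping.lookup (T p) m"
    by (simp add: T lookup_sum F_def)
  finally show "Poly_Mapping.lookup (T (T p)) m = Poly_Mapping.lookup (T p) m" .
qed

section \<open>The dimension as a trace\<close>

lemma dim_rel_sym_polys_dihedral:
  assumes "n \<ge> 3" "\<not> n dvd 2 * h"
  shows "real (dim_rel_sym_polys n d (dihedral n) (dihedral_char n h))
    = 2 / real n * (\<Sum>r | r dvd n. hoelder h (n div r) * real (cycle_count r (n div r) d))"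
proof -
  interpret vector_space cpoly_scale by (rule vector_space_cpoly_scale)
  have n: "n > 0" using assms by simp
  define T where "T = sym_operator (dihedral n) (dihedral_char n h)"
  define M where "M = periodic_monoms n d n"
  define c where "c k = 2 * cos (2 * pi * real h * real k / real n)" for k
  have T: "T p = cpoly_scale (1 / of_nat n)
      (\<Sum>k<n. cpoly_scale (of_real (c k)) (perm_poly (rotation n ^^ k) p))" for p
    using sym_operator_dihedral[OF assms(1)] by (simp add: T_def c_def)
  have fin: "finite M"
    unfolding M_def using n by (intro finite_periodic_monoms) auto
  have V: "subspace (hom_polys n d)"
  proof -
    have "hom_polys n d = {p. \<forall>m. m \<notin> M \<longrightarrow> Poly_Mapping.lookup p m = 0}"
      by (auto simp: hom_polys_eq M_def in_keys_iff)
    then show ?thesis by (simp add: subspace_def lookup_add)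
  qed
  have count: "(\<Sum>m\<in>M. if perm_monom (rotation n ^^ k) m = m then of_real (c k) else 0)
      = complex_of_real (c k * real (cycle_count (gcd k n) (n div gcd k n) d))" for k
  proof -
    have "(\<Sum>m\<in>M. if perm_monom (rotation n ^^ k) m = m then complex_of_real (c k) else 0)
        = of_real (c k * real (card {m \<in> M. perm_monom (rotation n ^^ k) m = m}))"
      using fin by (simp add: sum.If_cases Int_def conj_commute)
    then show ?thesis
      using n by (simp add: M_def perm_monom_rotation_fixed card_periodic_monoms)
  qed
  have "of_nat (dim (T ` hom_polys n d))
      = (\<Sum>m\<in>M. Poly_Mapping.lookup (T (Poly_Mapping.single m 1)) m)"
  proof (rule dim_idempotent_image_eq_trace)
    show "Vector_Spaces.linear cpoly_scale cpoly_scale T"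
      unfolding Vector_Spaces.linear_iff
    proof (intro conjI allI poly_mapping_eqI)
      show "Poly_Mapping.lookup (T (p + q)) m = Poly_Mapping.lookup (T p + T q) m" for p q m
        by (simp add: T lookup_sum lookup_add perm_poly_eq pushforward_add sum.distrib distrib_left)
      show "Poly_Mapping.lookup (T (cpoly_scale a p)) m
          = Poly_Mapping.lookup (cpoly_scale a (T p)) m" for a p m
        by (simp add: T lookup_sum perm_poly_scale sum_distrib_left mult_ac)
    qed (rule vector_space_cpoly_scale)+
    show "T p \<in> hom_polys n d" if "p \<in> hom_polys n d" for p
      unfolding T using that V n
      by (intro subspace_scale subspace_sum perm_poly_rotation_hom_polys) auto
    show "T (T p) = T p" for p
      unfolding T_def by (rule sym_operator_dihedral_idem[OF assms])
    show "Poly_Mapping.single m 1 \<in> hom_polys n d" if "m \<in> M" for m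
      using that by (simp add: hom_polys_eq M_def)
    show "Vector_Spaces.linear cpoly_scale (*) (\<lambda>p. Poly_Mapping.lookup p m)" for m :: monom
      unfolding Vector_Spaces.linear_iff
    proof (intro conjI allI)
      show "vector_space ((*) :: complex \<Rightarrow> complex \<Rightarrow> complex)"
        by unfold_locales (simp_all add: algebra_simps)
    qed (simp_all add: vector_space_cpoly_scale lookup_add)
    show "p = (\<Sum>m\<in>M. cpoly_scale (Poly_Mapping.lookup p m) (Poly_Mapping.single m 1))"
      if "p \<in> hom_polys n d" for p
    proof (rule poly_mapping_eqI)
      fix x
      have "Poly_Mapping.lookup p x = 0" if "x \<notin> M"
        using that \<open>p \<in> hom_polys n d\<close> by (auto simp: hom_polys_eq M_def in_keys_iff)
      then show "Poly_Mapping.lookup p x = Poly_Mapping.lookup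
          (\<Sum>m\<in>M. cpoly_scale (Poly_Mapping.lookup p m) (Poly_Mapping.single m 1)) x"
        using fin by (simp add: lookup_sum lookup_single when_def if_distrib cong: if_cong)
    qed
  qed (use V fin in auto)
  \<comment> \<open>A rotation permutes monomials, so its diagonal entry at \<open>m\<close> is 1 if
    it fixes \<open>m\<close> and 0 otherwise.\<close>
  also have "\<dots> = (\<Sum>m\<in>M. 1 / of_nat n * (\<Sum>k<n.
      if perm_monom (rotation n ^^ k) m = m then of_real (c k) else 0))"
    by (simp add: T lookup_sum perm_poly_eq lookup_single when_def if_distrib cong: if_cong)
  also have "\<dots> = 1 / of_nat n * (\<Sum>k<n. \<Sum>m\<in>M.
      if perm_monom (rotation n ^^ k) m = m then of_real (c k) else 0)"
    by (subst sum.swap) (simp only: sum_distrib_left)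
  also have "\<dots> = of_real (2 / real n * (\<Sum>k<n. cos (2 * pi * real h * real k / real n)
        * real (cycle_count (gcd k n) (n div gcd k n) d)))"
    unfolding count by (simp add: c_def sum_distrib_left mult_ac)
  also have "(\<Sum>k<n. cos (2 * pi * real h * real k / real n)
        * real (cycle_count (gcd k n) (n div gcd k n) d))
      = (\<Sum>r | r dvd n. hoelder h (n div r) * real (cycle_count r (n div r) d))"
  proof -
    have "n div r > 0" if "r dvd n" for r using that n by (auto elim!: dvdE)
    then show ?thesis
      using sum_cos_gcd[OF n, of h "\<lambda>r. real (cycle_count r (n div r) d)"]
      by (simp add: ramanujan_sum_eq_hoelder)
  qed
  \<comment> \<open>The trace was computed over the complex numbers; injectivity of the embedding
    brings the equation back to the reals.\<close>
  finally show ?thesis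
    unfolding dim_rel_sym_polys_def rel_sym_polys_def T_def
    by (metis of_real_eq_iff of_real_of_nat_eq)
qed

text \<open>Both cases are one formula in terms of \<open>hoelder\<close>: unfolding it gives the
  second, and in the first every gcd is 1, so the totients cancel and only the Moebius value
  remains.\<close>

theorem theorem4p1:
  fixes n h :: nat
  assumes "n \<ge> 3" and "h > 0" and "real h < real n / 2"
  shows
    "(coprime h n \<longrightarrow>
       (\<forall>d::nat. real (dim_rel_sym_polys n d (dihedral n) (dihedral_char n h)) =
          2 / real n * (\<Sum>r | r dvd n.
            binom (real r + real d / (real n / real r) - 1) (real r - 1)
              * of_int (moebius (n div r)))) \<and>
       Abs_fps (\<lambda>d. real (dim_rel_sym_polys n d (dihedral n) (dihedral_char n h))) =
          fps_const (2 / real n) * (\<Sum>r | r dvd n.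
            fps_const (of_int (moebius (n div r)))
              * inverse ((1 - fps_X ^ (n div r)) ^ r)))
     \<and>
     (\<not> coprime h n \<longrightarrow>
       (\<forall>d::nat. real (dim_rel_sym_polys n d (dihedral n) (dihedral_char n h)) =
          2 / real n * (\<Sum>r | r dvd n.
            let g = gcd h (n div r) in
            binom (real r + real d / (real n / real r) - 1) (real r - 1)
              * of_int (moebius ((n div r) div g))
              * (real (totient (n div r)) / real (totient ((n div r) div g))))) \<and>
       Abs_fps (\<lambda>d. real (dim_rel_sym_polys n d (dihedral n) (dihedral_char n h))) =
          fps_const (2 / real n) * (\<Sum>r | r dvd n.
            let g = gcd h (n div r) in
            fps_const (of_int (moebius ((n div r) div g))
                * (real (totient (n div r)) / real (totient ((n div r) div g))))
              * inverse ((1 - fps_X ^ (n div r)) ^ r)))"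
proof -
  let ?dim = "\<lambda>d. real (dim_rel_sym_polys n d (dihedral n) (dihedral_char n h))"
  have n: "n > 0" using assms by simp
  \<comment> \<open>The bounds on \<open>h\<close> put \<open>2 * h\<close> strictly between 0 and
    \<open>n\<close>.\<close>
  have "\<not> n dvd 2 * h" using assms by (auto dest: dvd_imp_le)
  note dim = dim_rel_sym_polys_dihedral[OF assms(1) this]
  have dim_binom: "?dim d = 2 / real n * (\<Sum>r | r dvd n.
      binom (real r + real d / (real n / real r) - 1) (real r - 1) * hoelder h (n div r))" for d
    unfolding dim
    by (rule arg_cong[where f = "\<lambda>s. 2 / real n * s"], intro sum.cong refl)
      (simp only: mem_Collect_eq binom_eq_cycle_count[OF n] mult.commute)
  have gf: "Abs_fps ?dim = fps_const (2 / real n) * (\<Sum>r | r dvd n.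
      fps_const (hoelder h (n div r)) * inverse ((1 - fps_X ^ (n div r)) ^ r))"
  proof (rule fps_ext)
    fix d
    have "inverse ((1 - fps_X ^ (n div r)) ^ r) $ d = real (cycle_count r (n div r) d)"
      if "r dvd n" for r
      using that n by (intro nth_inverse_one_minus_X_power) (auto elim!: dvdE)
    then show "Abs_fps ?dim $ d = (fps_const (2 / real n) * (\<Sum>r | r dvd n.
        fps_const (hoelder h (n div r)) * inverse ((1 - fps_X ^ (n div r)) ^ r))) $ d"
      by (simp add: dim fps_sum_nth)
  qed
  have coprime: "hoelder h (n div r) = of_int (moebius (n div r))" if "coprime h n" "r dvd n" for r
  proof -
    have "gcd h (n div r) = 1"
      using that by (metis coprime_iff_gcd_eq_1 coprime_mult_right_iff dvd_div_mult_self)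
    then show ?thesis using that n by (simp add: hoelder_def dvd_div_eq_0_iff)
  qed
  show ?thesis
  proof (intro conjI impI allI)
    assume "coprime h n"
    note cop = coprime[OF this]
    show "?dim d = 2 / real n * (\<Sum>r | r dvd n.
        binom (real r + real d / (real n / real r) - 1) (real r - 1) * of_int (moebius (n div r)))" for d
      unfolding dim_binom
      by (rule arg_cong[where f = "\<lambda>s. 2 / real n * s"], intro sum.cong refl)
        (simp only: mem_Collect_eq cop)
    show "Abs_fps ?dim = fps_const (2 / real n) * (\<Sum>r | r dvd n.
        fps_const (of_int (moebius (n div r))) * inverse ((1 - fps_X ^ (n div r)) ^ r))"
      unfolding gf
      by (rule arg_cong[where f = "\<lambda>s. fps_const (2 / real n) * s"], intro sum.cong refl)
        (simp only: mem_Collect_eq cop)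
  qed (simp only: dim_binom Let_def hoelder_def mult.assoc, simp only: gf Let_def hoelder_def)
qed

end
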